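(* Let $R,R'$ be rings, and let $K\subset R$, $K'\subset R'$ be proper subfields (not necessarily commutative, not necessarily central). Let $\phi:R\to R'$ be an antiisomorphism of rings such that $K^\phi={u'}^{-1}K'u'$ for some unit $u'\in {R'}^*$. Let $\iota:\mathbb{P}(R)\to\widehat{\mathbb{P}}(R):p\mapsto p^\perp$, let $\widehat\phi:\widehat{\mathbb{P}}(R)\to\mathbb{P}(R'):(v,w)^{\mathrm T}R\mapsto R'(v^\phi,w^\phi)$, and let $\eta:\mathbb{P}(R')\to\mathbb{P}(R'):R'(a',b')\mapsto R'(b',-a')$. Then $\sigma:=\iota\widehat\phi\eta$ (first $\iota$, then $\widehat\phi$, then $\eta$) is an isomorphism of the chain geometry $\Sigma(K,R)$ onto the chain geometry $\Sigma(K',R')$, and for every $n\ge 0$ and all $t_1,t_2,\ldots,t_n\in R$, $$\bigl(R(1,0)\cdot E(t_n)\cdot E(t_{n-1})\cdots E(t_1)\bigr)^\sigma=R'(1',0')\cdot E(t_n^\phi)\cdot E(t_{n-1}^\phi)\cdots E(t_1^\phi).$$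
   Context: Rings are associative with unit element $1$, preserved by homomorphisms and inherited by subrings; $0',1'$ denote the zero and unit of $R'$. A field need not be commutative. Mappings are written as exponents and products of mappings are read from left to right. An antiisomorphism is an additive bijection with $1^\phi=1'$ and $(xy)^\phi=y^\phi x^\phi$. For an element $t$ of a ring, $E(t):=\begin{pmatrix}t&1\\-1&0\end{pmatrix}$, an invertible matrix over that ring. Chain geometry. $\mathrm{GL}_2(R)$ acts from the right on the left $R$-module $R^2$ of rows. $\mathbb{P}(R)$ is the orbit of $R(1,0)$ under $\mathrm{GL}_2(R)$; points are always represented as $R(a,b)$ with $(a,b)$ the first row of some matrix in $\mathrm{GL}_2(R)$. The standard chain is $\{R(k,l)\mid (k,l)\in K^2\setminus\{(0,0)\}\}$; the set $\mathfrak{C}(K,R)$ of chains is its orbit under $\mathrm{GL}_2(R)$. $\Sigma(K,R)=(\mathbb{P}(R),\mathfrak{C}(K,R))$; similarly for $\Sigma(K',R')$. An isomorphism of chain geometries is a bijection of the point sets inducing a bijection of the chain sets. Dual projective line. $\mathrm{GL}_2(R)$ acts from the left on the right $R$-module $\widehat{R}^2$ of columns. $\widehat{\mathbb{P}}(R)$ is the set of all $M\cdot(1,0)^{\mathrm T}R$ with $M\in\mathrm{GL}_2(R)$; its points are always represented as $(v,w)^{\mathrm T}R$ with $(v,w)^{\mathrm T}$ the first column of some matrix in $\mathrm{GL}_2(R)$. For $p\in\mathbb{P}(R)$, $p^\perp:=\{(x,y)^{\mathrm T}\in\widehat{R}^2\mid ax+by=0\text{ for all }(a,b)\in p\}$,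 which is an element of $\widehat{\mathbb{P}}(R)$. (The points $R(1,0)\cdot E(t_n)\cdots E(t_1)$ are, by a known result, exactly the points in the connected component of $R(1,0)$ in the distant graph of $\mathbb{P}(R)$, whose edges are the pairs $\{R(a,b),R(c,d)\}$ with $\begin{pmatrix}a&b\\c&d\end{pmatrix}\in\mathrm{GL}_2(R)$.) *)

theory Defs
  imports "HOL-Analysis.Analysis"
begin

text \<open>
  Rings are types of class \<open>ring_1\<close>, hence non-trivial; this is no restriction for a ring
  containing a (not necessarily commutative) field with the same unit.
  Elements of \<open>R\<^sup>2\<close>, be they rows or columns, have type \<open>'a^2\<close>; \<open>GL\<^sub>2(R)\<close> consists of the
  matrices with \<open>invertible M\<close> (two-sided inverse), acting on rows by \<open>v*\<close> and on columns by \<open>*v\<close>.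
\<close>

definition is_subfield :: "'a::ring_1 set \<Rightarrow> bool" where
  "is_subfield K \<longleftrightarrow>
     1 \<in> K \<and> (\<forall>x\<in>K. \<forall>y\<in>K. x - y \<in> K \<and> x * y \<in> K) \<and>
     (\<forall>x\<in>K. x \<noteq> 0 \<longrightarrow> (\<exists>y\<in>K. x * y = 1 \<and> y * x = 1))"

definition proper_subfield :: "'a::ring_1 set \<Rightarrow> bool" where
  "proper_subfield K \<longleftrightarrow> is_subfield K \<and> K \<noteq> UNIV"

definition antiisomorphism :: "('a::ring_1 \<Rightarrow> 'b::ring_1) \<Rightarrow> bool" where
  "antiisomorphism \<phi> \<longleftrightarrow>
     bij \<phi> \<and> (\<forall>x y. \<phi> (x + y) = \<phi> x + \<phi> y) \<and> \<phi> 1 = 1 \<and> (\<forall>x y. \<phi> (x * y) = \<phi> y * \<phi> x)"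

definition E :: "'a::ring_1 \<Rightarrow> 'a^2^2" where
  "E t = vector [vector [t, 1], vector [-1, 0]]"

text \<open>\<open>E_prod t n\<close> is \<open>E(t\<^sub>n) \<cdot> E(t\<^sub>n\<^sub>-\<^sub>1) \<cdots> E(t\<^sub>1)\<close>; the value \<open>t 0\<close> is not used.\<close>

primrec E_prod :: "(nat \<Rightarrow> 'a::ring_1) \<Rightarrow> nat \<Rightarrow> 'a^2^2" where
  "E_prod t 0 = mat 1"
| "E_prod t (Suc n) = E (t (Suc n)) ** E_prod t n"


subsection \<open>Chain geometries\<close>

definition left_span :: "'a::ring_1^2 \<Rightarrow> ('a^2) set" where
  "left_span v = {r *s v | r. True}"

definition point_act :: "('a::ring_1^2) set \<Rightarrow> 'a^2^2 \<Rightarrow> ('a^2) set" where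
  "point_act p M = (\<lambda>v. v v* M) ` p"

definition proj_line :: "('a::ring_1^2) set set" where
  "proj_line = {point_act (left_span (vector [1, 0])) M | M. invertible M}"

definition standard_chain :: "'a::ring_1 set \<Rightarrow> ('a^2) set set" where
  "standard_chain K = {left_span (vector [k, l]) | k l. k \<in> K \<and> l \<in> K \<and> (k, l) \<noteq> (0, 0)}"

definition chain_set :: "'a::ring_1 set \<Rightarrow> ('a^2) set set set" where
  "chain_set K = {(\<lambda>p. point_act p M) ` standard_chain K | M. invertible M}"

definition chain_geometry :: "'a::ring_1 set \<Rightarrow> ('a^2) set set \<times> ('a^2) set set set" where
  "chain_geometry K = (proj_line, chain_set K)"

definition geometry_iso ::
    "('p \<Rightarrow> 'q) \<Rightarrow> 'p set \<times> 'p set set \<Rightarrow> 'q set \<times> 'q set set \<Rightarrow> bool" where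
  "geometry_iso \<sigma> G G' \<longleftrightarrow>
     bij_betw \<sigma> (fst G) (fst G') \<and> bij_betw (\<lambda>C. \<sigma> ` C) (snd G) (snd G')"


subsection \<open>The dual projective line and the maps between the lines\<close>

definition right_span :: "'a::ring_1^2 \<Rightarrow> ('a^2) set" where
  "right_span v = {(\<chi> i. v $ i * r) | r. True}"

definition dual_proj_line :: "('a::ring_1^2) set set" where
  "dual_proj_line = {(\<lambda>v. M *v v) ` right_span (vector [1, 0]) | M. invertible M}"

definition perp :: "('a::ring_1^2) set \<Rightarrow> ('a^2) set" where
  "perp p = {x. \<forall>v\<in>p. v $ 1 * x $ 1 + v $ 2 * x $ 2 = 0}"

text \<open>
  The next two maps are given on admissible representatives of points. Independence of the
  representative is shown in \<open>hat_map_right_span\<close> and \<open>eta_left_span\<close> below.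
\<close>

definition hat_map :: "('a::ring_1 \<Rightarrow> 'b::ring_1) \<Rightarrow> ('a^2) set \<Rightarrow> ('b^2) set" where
  "hat_map \<phi> p =
     (THE q. \<exists>v w. (\<exists>M :: 'a^2^2. invertible M \<and> column 1 M = vector [v, w]) \<and>
        p = right_span (vector [v, w]) \<and> q = left_span (vector [\<phi> v, \<phi> w]))"

definition eta :: "('b::ring_1^2) set \<Rightarrow> ('b^2) set" where
  "eta p =
     (THE q. \<exists>a b. (\<exists>M :: 'b^2^2. invertible M \<and> row 1 M = vector [a, b]) \<and>
        p = left_span (vector [a, b]) \<and> q = left_span (vector [b, - a]))"

definition antiiso_point_map :: "('a::ring_1 \<Rightarrow> 'b::ring_1) \<Rightarrow> ('a^2) set \<Rightarrow> ('b^2) set" where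
  "antiiso_point_map \<phi> p = eta (hat_map \<phi> (perp p))"


subsection \<open>Well-definedness\<close>

lemma vec2_eq_iff: "v = w \<longleftrightarrow> v $ 1 = w $ 1 \<and> v $ 2 = w $ 2" for v w :: "'a^2"
  by (simp add: vec_eq_iff forall_2)

lemma left_span_vector:
  "left_span (vector [a, b]) = {vector [r * a, r * b] | r. True}" for a b :: "'a::ring_1"
  unfolding left_span_def by (simp add: vector_scalar_mult_def vec2_eq_iff set_eq_iff)

lemma right_span_vector:
  "right_span (vector [a, b]) = {vector [a * r, b * r] | r. True}" for a b :: "'a::ring_1"
  unfolding right_span_def by (simp add: vec2_eq_iff set_eq_iff)

lemma vector2_eq_iff [simp]:
  "(vector [a, b] :: 'a::zero^2) = vector [c, d] \<longleftrightarrow> a = c \<and> b = d"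
  by (simp add: vec2_eq_iff)

lemma left_span_eqI:
  fixes a b :: "'a::ring_1"
  assumes "r * a = c" "r * b = d" "s * c = a" "s * d = b"
  shows "left_span (vector [a, b]) = left_span (vector [c, d])"
proof -
  have "\<exists>x'. x * a = x' * c \<and> x * b = x' * d" for x
    using assms(3,4) by (intro exI[of _ "x * s"]) (simp add: mult.assoc)
  moreover have "\<exists>x'. x * c = x' * a \<and> x * d = x' * b" for x
    using assms(1,2) by (intro exI[of _ "x * r"]) (simp add: mult.assoc)
  ultimately show ?thesis
    unfolding left_span_vector set_eq_iff by (auto simp: vec2_eq_iff)
qed

lemma left_span_eqD:
  fixes a b :: "'a::ring_1"
  assumes "left_span (vector [a, b]) = left_span (vector [c, d])"
  shows "\<exists>r. r * a = c \<and> r * b = d"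
proof -
  have "vector [c, d] \<in> left_span (vector [c, d])"
    unfolding left_span_vector by (auto intro!: exI[of _ 1])
  with assms have "vector [c, d] \<in> left_span (vector [a, b])" by simp
  then show ?thesis unfolding left_span_vector by (auto simp: vec2_eq_iff)
qed

lemma right_span_eqD:
  fixes a b :: "'a::ring_1"
  assumes "right_span (vector [a, b]) = right_span (vector [c, d])"
  shows "\<exists>r. a * r = c \<and> b * r = d"
proof -
  have "vector [c, d] \<in> right_span (vector [c, d])"
    unfolding right_span_vector by (auto intro!: exI[of _ 1])
  with assms have "vector [c, d] \<in> right_span (vector [a, b])" by simp
  then show ?thesis unfolding right_span_vector by (auto simp: vec2_eq_iff)
qed

lemma perp_in_dual_proj_line:
  fixes p :: "('a::ring_1^2) set"
  assumes "p \<in> proj_line"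
  shows "perp p \<in> dual_proj_line"
proof -
  obtain M :: "'a^2^2" where M: "invertible M" and p: "p = point_act (left_span (vector [1, 0])) M"
    using assms unfolding proj_line_def by blast
  then obtain N where N: "M ** N = mat 1" "N ** M = mat 1"
    unfolding invertible_def by blast
  define S :: "'a^2^2" where "S = vector [vector [0, 1], vector [1, 0]]"
  have SS: "S ** S = mat 1"
    by (simp add: S_def matrix_matrix_mult_def mat_def vec_eq_iff forall_2 sum_2)
  have inv: "invertible (N ** S)"
    using N SS by (intro invertible_mult) (auto simp: invertible_def)
  have perp_iff: "x \<in> perp p \<longleftrightarrow> (M *v x) $ 1 = 0" for x
  proof -
    have "x \<in> perp p \<longleftrightarrow> (\<forall>r. r * (M *v x) $ 1 = 0)"
    proof -
      have "p = {vector [r * M $ 1 $ 1, r * M $ 1 $ 2] | r. True}"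
      proof -
        have "vector [r * 1, r * 0] v* M = vector [r * M $ 1 $ 1, r * M $ 1 $ 2]" for r
          by (simp add: vec2_eq_iff vector_matrix_mult_def sum_2)
        then show ?thesis
          unfolding p point_act_def left_span_vector by (force simp: image_iff)
      qed
      then show ?thesis
        by (auto simp: perp_def matrix_vector_mult_def sum_2 distrib_left mult.assoc)
    qed
    then show ?thesis by (metis mult_1 mult_zero_right)
  qed
  have "perp p = (\<lambda>v. (N ** S) *v v) ` right_span (vector [1, 0])"
  proof (intro set_eqI iffI)
    fix x assume "x \<in> perp p"
    then have "S *v (M *v x) = vector [1 * (M *v x) $ 2, 0 * (M *v x) $ 2]"
      by (simp add: perp_iff S_def vec2_eq_iff matrix_vector_mult_def[of "vector _"] sum_2)
    moreover have "x = (N ** S) *v (S *v (M *v x))"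
      by (metis N(2) SS matrix_mul_assoc matrix_mul_rid matrix_vector_mul_assoc
          matrix_vector_mul_lid)
    ultimately show "x \<in> (\<lambda>v. (N ** S) *v v) ` right_span (vector [1, 0])"
      unfolding right_span_vector by blast
  next
    fix x assume "x \<in> (\<lambda>v. (N ** S) *v v) ` right_span (vector [1, 0])"
    then obtain r where "x = (N ** S) *v vector [1 * r, 0 * r]"
      unfolding right_span_vector by blast
    then have "M *v x = S *v vector [r, 0]"
      by (simp add: matrix_vector_mul_assoc matrix_mul_assoc N(1))
    then show "x \<in> perp p"
      by (simp add: perp_iff S_def matrix_vector_mult_def sum_2)
  qed
  with inv show ?thesis
    unfolding dual_proj_line_def by blast
qed

lemma hat_map_right_span:
  fixes \<phi> :: "'a::ring_1 \<Rightarrow> 'b::ring_1" and M :: "'a^2^2"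
  assumes "antiisomorphism \<phi>" "invertible M" "column 1 M = vector [v, w]"
  shows "hat_map \<phi> (right_span (vector [v, w])) = left_span (vector [\<phi> v, \<phi> w])"
  unfolding hat_map_def
proof (rule the_equality)
  fix q
  assume "\<exists>v' w'. (\<exists>M :: 'a^2^2. invertible M \<and> column 1 M = vector [v', w']) \<and>
    right_span (vector [v, w]) = right_span (vector [v', w']) \<and>
    q = left_span (vector [\<phi> v', \<phi> w'])"
  then obtain v' w' where eq: "right_span (vector [v, w]) = right_span (vector [v', w'])"
    and q: "q = left_span (vector [\<phi> v', \<phi> w'])" by blast
  obtain r s where "v * r = v'" "w * r = w'" "v' * s = v" "w' * s = w"
    using right_span_eqD[OF eq] right_span_eqD[OF eq[symmetric]] by blast
  moreover have "\<phi> (x * y) = \<phi> y * \<phi> x" for x y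
    using assms(1) by (simp add: antiisomorphism_def)
  ultimately show "q = left_span (vector [\<phi> v, \<phi> w])"
    unfolding q by - (rule left_span_eqI[where r = "\<phi> s" and s = "\<phi> r"]; metis)
qed (use assms in blast)

lemma eta_left_span:
  fixes M :: "'b::ring_1^2^2"
  assumes "invertible M" "row 1 M = vector [a, b]"
  shows "eta (left_span (vector [a, b])) = left_span (vector [b, - a])"
  unfolding eta_def
proof (rule the_equality)
  fix q
  assume "\<exists>a' b'. (\<exists>M :: 'b^2^2. invertible M \<and> row 1 M = vector [a', b']) \<and>
    left_span (vector [a, b]) = left_span (vector [a', b']) \<and> q = left_span (vector [b', - a'])"
  then obtain a' b' where eq: "left_span (vector [a, b]) = left_span (vector [a', b'])"
    and q: "q = left_span (vector [b', - a'])" by blast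
  obtain r s where "r * a = a'" "r * b = b'" "s * a' = a" "s * b' = b"
    using left_span_eqD[OF eq] left_span_eqD[OF eq[symmetric]] by blast
  then show "q = left_span (vector [b, - a])"
    unfolding q by - (rule left_span_eqI[where r = s and s = r]; simp)
qed (use assms in blast)

end

theory Submission
  imports Defs
begin

text \<open>
  If \<open>M\<close> has inverse \<open>N\<close>, then the perp of \<open>R(1, 0) \<cdot> M\<close> is spanned by the second column of
  \<open>N\<close>, so \<open>\<sigma>\<close> sends \<open>R(1, 0) \<cdot> M\<close> to \<open>R'(1', 0') \<cdot> T(N)\<close>, where \<open>T = twisted_adj \<phi>\<close>
  applies \<open>\<phi>\<close> to the entries of the formal adjugate of \<open>N\<close>. Over a noncommutative ring the adjugate is of no use as
  an inverse, but since \<open>\<phi>\<close> reverses products, \<open>T\<close> does too. Hence \<open>M \<mapsto> T(M\<inverse>)\<close> is an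
  isomorphism of the general linear groups with respect to which \<open>\<sigma>\<close> is equivariant. It maps
  \<open>E(t)\<close> to \<open>E(t\<^sup>\<phi>)\<close>, and \<open>\<sigma>\<close> maps the standard chain of \<open>K\<close> to the image of that of \<open>K'\<close>
  under \<open>diag(u', u')\<close>.
\<close>

section \<open>Two-by-two matrices, their action on points, and perps\<close>

lemma matrix2_eq_iff:
  "A = B \<longleftrightarrow> A $ 1 $ 1 = B $ 1 $ 1 \<and> A $ 1 $ 2 = B $ 1 $ 2 \<and> A $ 2 $ 1 = B $ 2 $ 1 \<and> A $ 2 $ 2 = B $ 2 $ 2"
  for A B :: "'a^2^2"
  by (auto simp: vec2_eq_iff)

lemma matrix2_mult_nth: "(A ** B) $ i $ j = A $ i $ 1 * B $ 1 $ j + A $ i $ 2 * B $ 2 $ j"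
  for A B :: "'a::semiring_1^2^2"
  by (simp add: matrix_matrix_mult_def sum_2)

lemma mat_1_nth2:
  "(mat 1 :: 'a::semiring_1^2^2) $ 1 $ 1 = 1" "(mat 1 :: 'a^2^2) $ 1 $ 2 = 0"
  "(mat 1 :: 'a^2^2) $ 2 $ 1 = 0" "(mat 1 :: 'a^2^2) $ 2 $ 2 = 1"
  by (simp_all add: mat_def)

lemmas matrix2_simps = matrix2_eq_iff matrix2_mult_nth mat_1_nth2

lemma point_act_mult: "point_act (point_act p M) N = point_act p (M ** N)"
  for M N :: "'a::ring_1^2^2"
proof -
  have "(v v* M) v* N = v v* (M ** N)" for v :: "'a^2"
    by (simp add: vec2_eq_iff vector_matrix_mult_def sum_2 matrix2_mult_nth
        distrib_left distrib_right mult.assoc add_ac)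
  then show ?thesis
    by (simp add: point_act_def image_image)
qed

lemma point_act_left_span:
  "point_act (left_span (vector [a, b])) M =
     left_span (vector [a * M $ 1 $ 1 + b * M $ 2 $ 1, a * M $ 1 $ 2 + b * M $ 2 $ 2])"
  for M :: "'a::ring_1^2^2"
proof -
  have "vector [r * a, r * b] v* M =
      vector [r * (a * M $ 1 $ 1 + b * M $ 2 $ 1), r * (a * M $ 1 $ 2 + b * M $ 2 $ 2)]" for r
    by (simp add: vec2_eq_iff vector_matrix_mult_def sum_2 distrib_left mult.assoc)
  then show ?thesis
    unfolding point_act_def left_span_vector by (force simp: image_iff)
qed

lemma point_act_base:
  "point_act (left_span (vector [1, 0])) M = left_span (vector [M $ 1 $ 1, M $ 1 $ 2])"
  for M :: "'a::ring_1^2^2"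
  by (simp add: point_act_left_span)

lemma point_act_in_proj_line:
  assumes "p \<in> proj_line" "invertible M"
  shows "point_act p M \<in> proj_line"
  using assms unfolding proj_line_def by (auto simp: point_act_mult intro!: invertible_mult)

text \<open>Pairing the first row of \<open>M\<close> with \<open>x\<close> computes the first
  coordinate of \<open>M *v x\<close>. If that vanishes, \<open>x = N *v (M *v x)\<close> involves
  only the second column of \<open>N\<close>; conversely, the (1, 2) entry of \<open>M ** N\<close>
  is 0.\<close>

lemma perp_point_act_base:
  fixes M N :: "'a::ring_1^2^2"
  assumes "M ** N = mat 1" "N ** M = mat 1"
  shows "perp (point_act (left_span (vector [1, 0])) M) = right_span (vector [N $ 1 $ 2, N $ 2 $ 2])"
    (is "?P = ?Q")
proof -
  have point: "point_act (left_span (vector [1, 0])) M = {vector [r * M $ 1 $ 1, r * M $ 1 $ 2] | r. True}"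
    unfolding point_act_base by (rule left_span_vector)
  show ?thesis
  proof (intro set_eqI iffI)
    fix x
    assume "x \<in> ?P"
    then have "\<forall>r. r * M $ 1 $ 1 * x $ 1 + r * M $ 1 $ 2 * x $ 2 = 0"
      unfolding perp_def point by auto
    from spec[OF this, of 1] have "(M *v x) $ 1 = 0"
      by (simp add: matrix_vector_mult_def sum_2)
    moreover have "x = N *v (M *v x)"
      by (simp add: matrix_vector_mul_assoc assms)
    ultimately have "x = vector [N $ 1 $ 2 * (M *v x) $ 2, N $ 2 $ 2 * (M *v x) $ 2]"
      by (metis (no_types, lifting) add_0 matrix_vector_mult_def mult_zero_right sum_2 vec_lambda_beta
          vec2_eq_iff vector_2)
    then show "x \<in> ?Q"
      unfolding right_span_vector by blast
  next
    fix x
    assume "x \<in> ?Q"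
    then obtain s where x: "x = vector [N $ 1 $ 2 * s, N $ 2 $ 2 * s]"
      unfolding right_span_vector by blast
    have "M $ 1 $ 1 * N $ 1 $ 2 + M $ 1 $ 2 * N $ 2 $ 2 = 0"
      using assms(1) by (simp add: matrix2_simps)
    moreover have "r * M $ 1 $ 1 * x $ 1 + r * M $ 1 $ 2 * x $ 2 =
        r * (M $ 1 $ 1 * N $ 1 $ 2 + M $ 1 $ 2 * N $ 2 $ 2) * s" for r
      by (simp add: x distrib_left distrib_right mult.assoc)
    ultimately show "x \<in> ?P"
      unfolding perp_def point by auto
  qed
qed

section \<open>The twisted adjugate\<close>

definition twisted_adj :: "('a::ring_1 \<Rightarrow> 'b::ring_1) \<Rightarrow> 'a^2^2 \<Rightarrow> 'b^2^2" where
  "twisted_adj \<phi> N =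
     vector [vector [\<phi> (N $ 2 $ 2), - \<phi> (N $ 1 $ 2)], vector [- \<phi> (N $ 2 $ 1), \<phi> (N $ 1 $ 1)]]"

lemma antiisomorphism_simps:
  assumes "antiisomorphism \<phi>"
  shows "\<phi> (x + y) = \<phi> x + \<phi> y" "\<phi> (x * y) = \<phi> y * \<phi> x" "\<phi> 1 = 1" "\<phi> 0 = 0" "\<phi> (- x) = - \<phi> x"
proof -
  show add: "\<phi> (x + y) = \<phi> x + \<phi> y" for x y
    using assms by (simp add: antiisomorphism_def)
  show "\<phi> (x * y) = \<phi> y * \<phi> x" "\<phi> 1 = 1"
    using assms by (simp_all add: antiisomorphism_def)
  show zero: "\<phi> 0 = 0"
    using add[of 0 0] by simp
  show "\<phi> (- x) = - \<phi> x"
    using add[of "- x" x] by (simp add: zero eq_neg_iff_add_eq_0)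
qed

lemma antiisomorphism_inv:
  assumes "antiisomorphism \<phi>"
  shows "antiisomorphism (inv \<phi>)"
proof -
  note simps = antiisomorphism_simps[OF assms]
  have bij: "bij \<phi>"
    using assms by (simp add: antiisomorphism_def)
  then have "\<phi> (inv \<phi> x) = x" "inv \<phi> (\<phi> y) = y" for x y
    by (simp_all add: bij_is_inj bij_is_surj surj_f_inv_f)
  then have "inv \<phi> (x + y) = inv \<phi> x + inv \<phi> y" "inv \<phi> (x * y) = inv \<phi> y * inv \<phi> x" "inv \<phi> 1 = 1" for x y
    by (metis simps(1), metis simps(2), metis simps(3))
  with bij show ?thesis
    by (simp add: antiisomorphism_def bij_imp_bij_inv)
qed

text \<open>Applying \<open>\<phi>\<close> entrywise and transposing reverses matrix products over
  any ring. The formal adjugate is the transpose conjugated by the matrix with rows (0, 1) and (-1,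
  0), so the reversal survives.\<close>

lemma twisted_adj_mult:
  assumes "antiisomorphism \<phi>"
  shows "twisted_adj \<phi> (M ** N) = twisted_adj \<phi> N ** twisted_adj \<phi> M"
  by (simp add: twisted_adj_def matrix2_simps antiisomorphism_simps[OF assms] add_ac)

lemma twisted_adj_mat_1:
  assumes "antiisomorphism \<phi>"
  shows "twisted_adj \<phi> (mat 1) = mat 1"
  by (simp add: twisted_adj_def matrix2_simps antiisomorphism_simps[OF assms])

text \<open>The formal adjugate is an involution: the diagonal entries are swapped twice and the
  signs off the diagonal cancel.\<close>

lemma twisted_adj_inverse:
  assumes "antiisomorphism \<phi>" "antiisomorphism \<psi>" "\<And>x. \<psi> (\<phi> x) = x"
  shows "twisted_adj \<psi> (twisted_adj \<phi> M) = M"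
  by (simp add: twisted_adj_def matrix2_simps antiisomorphism_simps[OF assms(2)] assms(3))

lemma twisted_adj_mult_eq_1:
  assumes "antiisomorphism \<phi>" "M ** N = mat 1"
  shows "twisted_adj \<phi> N ** twisted_adj \<phi> M = mat 1"
  by (metis assms twisted_adj_mult twisted_adj_mat_1)

lemma invertible_twisted_adj:
  assumes "antiisomorphism \<phi>" "invertible M"
  shows "invertible (twisted_adj \<phi> M)"
  using assms unfolding invertible_def by (metis twisted_adj_mult_eq_1)

section \<open>The map on points: formula, equivariance, bijectivity\<close>

text \<open>With (b, d) the second column of \<open>N\<close>, the three maps give in turn the
  column (b, d), the row (\<open>\<phi> b\<close>, \<open>\<phi> d\<close>) and the row
  (\<open>\<phi> d\<close>, \<open>- \<phi> b\<close>), which is the first row of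
  \<open>twisted_adj \<phi> N\<close>. What remains is to see that the representatives are
  admissible.\<close>

lemma antiiso_point_map_base:
  fixes M N :: "'a::ring_1^2^2" and \<phi> :: "'a \<Rightarrow> 'b::ring_1"
  assumes \<phi>: "antiisomorphism \<phi>" and MN: "M ** N = mat 1" "N ** M = mat 1"
  shows "antiiso_point_map \<phi> (point_act (left_span (vector [1, 0])) M) =
    point_act (left_span (vector [1, 0])) (twisted_adj \<phi> N)"
proof -
  \<comment> \<open>Right multiplication by \<open>S\<close> swaps columns, so the second column of
    \<open>N\<close> becomes the first column of an invertible matrix, as
    \<open>hat_map_right_span\<close> requires.\<close>
  define S :: "'a^2^2" where "S = vector [vector [0, 1], vector [1, 0]]"
  have "S ** S = mat 1"
    by (simp add: S_def matrix2_simps)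
  then have "invertible (N ** S)"
    using MN by (intro invertible_mult) (auto simp: invertible_def)
  moreover have "column 1 (N ** S) = vector [N $ 1 $ 2, N $ 2 $ 2]"
    by (simp add: vec2_eq_iff column_def matrix2_mult_nth S_def)
  ultimately have hat: "hat_map \<phi> (right_span (vector [N $ 1 $ 2, N $ 2 $ 2])) =
      left_span (vector [\<phi> (N $ 1 $ 2), \<phi> (N $ 2 $ 2)])"
    by (rule hat_map_right_span[OF \<phi>])
  \<comment> \<open>Right multiplication by \<open>J\<close> turns a row (x, y) into (-y, x).
    Applied to \<open>twisted_adj \<phi> N\<close>, it yields an invertible matrix whose first row
    is the argument of \<open>eta\<close>.\<close>
  define J :: "'b^2^2" where "J = vector [vector [0, 1], vector [- 1, 0]]"
  have "J ** (- J) = mat 1" "- J ** J = mat 1"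
    by (simp_all add: J_def matrix2_simps)
  then have "invertible J"
    unfolding invertible_def by blast
  moreover have "invertible N"
    using MN unfolding invertible_def by blast
  ultimately have "invertible (twisted_adj \<phi> N ** J)"
    using invertible_twisted_adj[OF \<phi>] by (intro invertible_mult)
  moreover have "row 1 (twisted_adj \<phi> N ** J) = vector [\<phi> (N $ 1 $ 2), \<phi> (N $ 2 $ 2)]"
    by (simp add: vec2_eq_iff row_def matrix2_mult_nth J_def twisted_adj_def)
  ultimately have "eta (left_span (vector [\<phi> (N $ 1 $ 2), \<phi> (N $ 2 $ 2)])) =
      left_span (vector [\<phi> (N $ 2 $ 2), - \<phi> (N $ 1 $ 2)])"
    by (rule eta_left_span)
  then show ?thesis
    unfolding antiiso_point_map_def perp_point_act_base[OF MN] hat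
    by (simp add: point_act_base twisted_adj_def)
qed

text \<open>For \<open>p\<close> given by \<open>A\<close> with inverse \<open>B\<close>, the moved
  point is given by \<open>A ** M\<close> with inverse \<open>N ** B\<close>. Inversion and
  \<open>twisted_adj\<close> both reverse products, so the factor from \<open>M\<close> ends up on
  the right again.\<close>

lemma antiiso_point_map_point_act:
  assumes \<phi>: "antiisomorphism \<phi>" and MN: "M ** N = mat 1" "N ** M = mat 1"
    and p: "p \<in> proj_line"
  shows "antiiso_point_map \<phi> (point_act p M) = point_act (antiiso_point_map \<phi> p) (twisted_adj \<phi> N)"
proof -
  obtain A B where A: "p = point_act (left_span (vector [1, 0])) A" "A ** B = mat 1" "B ** A = mat 1"
    using p unfolding proj_line_def invertible_def by blast
  have "(A ** M) ** (N ** B) = mat 1"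
    by (metis A(2) MN(1) matrix_mul_assoc matrix_mul_rid)
  moreover have "(N ** B) ** (A ** M) = mat 1"
    by (metis A(3) MN(2) matrix_mul_assoc matrix_mul_rid)
  ultimately show ?thesis
    by (simp add: A(1) point_act_mult antiiso_point_map_base[OF \<phi> A(2,3)]
        antiiso_point_map_base[OF \<phi>] twisted_adj_mult[OF \<phi>])
qed

lemma antiiso_point_map_in_proj_line:
  assumes \<phi>: "antiisomorphism \<phi>" and p: "p \<in> proj_line"
  shows "antiiso_point_map \<phi> p \<in> proj_line"
proof -
  obtain A B where A: "p = point_act (left_span (vector [1, 0])) A" "A ** B = mat 1" "B ** A = mat 1"
    using p unfolding proj_line_def invertible_def by blast
  then have "invertible (twisted_adj \<phi> B)"
    using invertible_twisted_adj[OF \<phi>] unfolding invertible_def by blast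
  then show ?thesis
    using A antiiso_point_map_base[OF \<phi>] unfolding proj_line_def by blast
qed

text \<open>Since \<open>twisted_adj \<phi> B\<close> has the inverse
  \<open>twisted_adj \<phi> A\<close>, applying the base formula a second time gives
  \<open>twisted_adj \<psi> (twisted_adj \<phi> A)\<close>, which is \<open>A\<close>.\<close>

lemma antiiso_point_map_inverse:
  assumes \<phi>: "antiisomorphism \<phi>" and \<psi>: "antiisomorphism \<psi>" and inv: "\<And>x. \<psi> (\<phi> x) = x"
    and p: "p \<in> proj_line"
  shows "antiiso_point_map \<psi> (antiiso_point_map \<phi> p) = p"
proof -
  obtain A B where A: "p = point_act (left_span (vector [1, 0])) A" "A ** B = mat 1" "B ** A = mat 1"
    using p unfolding proj_line_def invertible_def by blast
  show ?thesis
    unfolding A(1) antiiso_point_map_base[OF \<phi> A(2,3)]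
      antiiso_point_map_base[OF \<psi> twisted_adj_mult_eq_1[OF \<phi> A(2)] twisted_adj_mult_eq_1[OF \<phi> A(3)]]
      twisted_adj_inverse[OF \<phi> \<psi> inv] by (rule refl)
qed

lemma bij_betw_antiiso_point_map:
  fixes \<phi> :: "'a::ring_1 \<Rightarrow> 'b::ring_1"
  assumes \<phi>: "antiisomorphism \<phi>"
  shows "bij_betw (antiiso_point_map \<phi>) proj_line proj_line"
proof -
  have "bij \<phi>"
    using \<phi> by (simp add: antiisomorphism_def)
  then have inv: "\<phi> (inv \<phi> x) = x" "inv \<phi> (\<phi> y) = y" for x y
    by (simp_all add: bij_is_inj bij_is_surj surj_f_inv_f)
  note \<psi> = antiisomorphism_inv[OF \<phi>]
  show ?thesis
    by (rule bij_betw_byWitness[where f' = "antiiso_point_map (inv \<phi>)"])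
      (auto simp: antiiso_point_map_inverse[OF \<phi> \<psi> inv(2)] antiiso_point_map_inverse[OF \<psi> \<phi> inv(1)]
        intro: antiiso_point_map_in_proj_line[OF \<phi>] antiiso_point_map_in_proj_line[OF \<psi>])
qed

section \<open>Standard chains and the set of chains\<close>

text \<open>In affine coordinates the map is just \<open>\<phi>\<close>: inverting the shear by
  \<open>m\<close> negates \<open>m\<close>, and the adjugate negates it back.\<close>

lemma affine_point:
  fixes m :: "'a::ring_1" and \<phi> :: "'a \<Rightarrow> 'b::ring_1"
  shows "left_span (vector [1, m]) \<in> proj_line"
    and "antiisomorphism \<phi> \<Longrightarrow>
      antiiso_point_map \<phi> (left_span (vector [1, m])) = left_span (vector [1, \<phi> m])"
proof -
  define A B :: "'a^2^2"
    where "A = vector [vector [1, m], vector [0, 1]]" and "B = vector [vector [1, - m], vector [0, 1]]"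
  have AB: "A ** B = mat 1" "B ** A = mat 1"
    by (simp_all add: A_def B_def matrix2_simps)
  have A: "left_span (vector [1, m]) = point_act (left_span (vector [1, 0])) A"
    by (simp add: point_act_base A_def)
  show "left_span (vector [1, m]) \<in> proj_line"
    unfolding A proj_line_def using AB invertible_def by blast
  show "antiiso_point_map \<phi> (left_span (vector [1, m])) = left_span (vector [1, \<phi> m])"
    if "antiisomorphism \<phi>"
    unfolding A antiiso_point_map_base[OF that AB]
    by (simp add: point_act_base B_def twisted_adj_def antiisomorphism_simps[OF that])
qed

lemma infinite_point:
  fixes \<phi> :: "'a::ring_1 \<Rightarrow> 'b::ring_1"
  shows "left_span (vector [0, 1 :: 'a]) \<in> proj_line"
    and "antiisomorphism \<phi> \<Longrightarrow>
      antiiso_point_map \<phi> (left_span (vector [0, 1])) = left_span (vector [0, 1])"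
proof -
  define A B :: "'a^2^2"
    where "A = vector [vector [0, 1], vector [- 1, 0]]" and "B = vector [vector [0, - 1], vector [1, 0]]"
  have AB: "A ** B = mat 1" "B ** A = mat 1"
    by (simp_all add: A_def B_def matrix2_simps)
  have A: "left_span (vector [0, 1]) = point_act (left_span (vector [1, 0])) A"
    by (simp add: point_act_base A_def)
  show "left_span (vector [0, 1 :: 'a]) \<in> proj_line"
    unfolding A proj_line_def using AB invertible_def by blast
  show "antiiso_point_map \<phi> (left_span (vector [0, 1])) = left_span (vector [0, 1])"
    if "antiisomorphism \<phi>"
    unfolding A antiiso_point_map_base[OF that AB]
    by (simp add: point_act_base B_def twisted_adj_def antiisomorphism_simps[OF that])
qed

text \<open>Scaling from the left by an inverse in \<open>K\<close> normalizes the first nonzero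
  coordinate to 1. This reduces chains to points on which the map is known explicitly.\<close>

lemma standard_chain_eq:
  assumes K: "is_subfield K"
  shows "standard_chain K = insert (left_span (vector [0, 1])) ((\<lambda>m. left_span (vector [1, m])) ` K)"
proof -
  have "1 \<in> K"
    using K by (simp add: is_subfield_def)
  have mult: "x * y \<in> K" if "x \<in> K" "y \<in> K" for x y
    using K that by (auto simp: is_subfield_def)
  have "0 \<in> K"
    using K unfolding is_subfield_def by (metis diff_self)
  have inverse: "\<exists>y\<in>K. x * y = 1 \<and> y * x = 1" if "x \<in> K" "x \<noteq> 0" for x
    using K that by (auto simp: is_subfield_def)
  have "left_span (vector [k, l]) \<in> insert (left_span (vector [0, 1])) ((\<lambda>m. left_span (vector [1, m])) ` K)"
    if kl: "k \<in> K" "l \<in> K" "(k, l) \<noteq> (0, 0)" for k l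
  proof (cases "k = 0")
    case True
    then obtain j where "l * j = 1" "j * l = 1"
      using inverse[of l] kl by auto
    then have "left_span (vector [k, l]) = left_span (vector [0, 1])"
      by (intro left_span_eqI[where r = j and s = l]) (auto simp: True)
    then show ?thesis
      by simp
  next
    case False
    then obtain j where j: "j \<in> K" "k * j = 1" "j * k = 1"
      using inverse[of k] kl by auto
    then have "left_span (vector [k, l]) = left_span (vector [1, j * l])"
      by (intro left_span_eqI[where r = j and s = k]) (auto simp flip: mult.assoc)
    then show ?thesis
      using mult j(1) kl(2) by blast
  qed
  moreover have "left_span (vector [0, 1]) \<in> standard_chain K"
    using \<open>0 \<in> K\<close> \<open>1 \<in> K\<close> unfolding standard_chain_def by force
  moreover have "left_span (vector [1, m]) \<in> standard_chain K" if "m \<in> K" for m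
    using that \<open>1 \<in> K\<close> unfolding standard_chain_def by force
  ultimately show ?thesis
    unfolding standard_chain_def by blast
qed

lemma standard_chain_subset_proj_line:
  assumes "is_subfield K"
  shows "standard_chain K \<subseteq> proj_line"
  using affine_point(1) infinite_point(1) by (auto simp: standard_chain_eq[OF assms])

lemma chain_set_subset_Pow_proj_line:
  assumes "is_subfield K"
  shows "chain_set K \<subseteq> Pow proj_line"
  using standard_chain_subset_proj_line[OF assms]
  unfolding chain_set_def by (auto intro!: point_act_in_proj_line)

lemma antiiso_point_map_standard_chain:
  fixes K :: "'a::ring_1 set" and K' :: "'b::ring_1 set"
  assumes K: "is_subfield K" "is_subfield K'" and \<phi>: "antiisomorphism \<phi>"
    and u: "u * v = 1" "v * u = 1" and conj: "\<phi> ` K = {v * k * u | k. k \<in> K'}"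
  shows "antiiso_point_map \<phi> ` standard_chain K =
    (\<lambda>p. point_act p (vector [vector [u, 0], vector [0, u]])) ` standard_chain K'"
proof -
  have 1: "point_act (left_span (vector [0, 1])) (vector [vector [u, 0], vector [0, u]]) =
      left_span (vector [0, 1])"
    unfolding point_act_left_span using u by (intro left_span_eqI[where r = v and s = u]) simp_all
  have 2: "point_act (left_span (vector [1, k])) (vector [vector [u, 0], vector [0, u]]) =
      left_span (vector [1, v * k * u])" for k
    unfolding point_act_left_span using u
    by (intro left_span_eqI[where r = v and s = u]) (simp_all flip: mult.assoc)
  have "(\<lambda>k. left_span (vector [1, v * k * u])) ` K' = (\<lambda>x. left_span (vector [1, x])) ` \<phi> ` K"
    unfolding conj by blast
  then show ?thesis
    by (simp add: standard_chain_eq K image_image 1 2 affine_point(2)[OF \<phi>] infinite_point(2)[OF \<phi>])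
qed

text \<open>By equivariance, the chain obtained from \<open>M\<close> goes to the standard chain of
  \<open>K'\<close> moved by \<open>D ** twisted_adj \<phi> N\<close>. This matrix is invertible,
  and every invertible matrix arises in this way.\<close>

lemma image_antiiso_point_map_chain_set:
  fixes K :: "'a::ring_1 set" and K' :: "'b::ring_1 set"
  assumes K: "is_subfield K" "is_subfield K'" and \<phi>: "antiisomorphism \<phi>"
    and u: "u * v = 1" "v * u = 1" and conj: "\<phi> ` K = {v * k * u | k. k \<in> K'}"
  shows "(\<lambda>C. antiiso_point_map \<phi> ` C) ` chain_set K = chain_set K'"
proof -
  define D :: "'b^2^2" where "D = vector [vector [u, 0], vector [0, u]]"
  define D' :: "'b^2^2" where "D' = vector [vector [v, 0], vector [0, v]]"
  have D: "D ** D' = mat 1" "D' ** D = mat 1"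
    using u by (simp_all add: D_def D'_def matrix2_simps)
  have image_chain: "antiiso_point_map \<phi> ` (\<lambda>p. point_act p M) ` standard_chain K =
      (\<lambda>p. point_act p (D ** twisted_adj \<phi> N)) ` standard_chain K'"
    if "M ** N = mat 1" "N ** M = mat 1" for M N
  proof -
    have "antiiso_point_map \<phi> ` (\<lambda>p. point_act p M) ` standard_chain K =
        (\<lambda>p. point_act p (twisted_adj \<phi> N)) ` antiiso_point_map \<phi> ` standard_chain K"
      unfolding image_image using standard_chain_subset_proj_line[OF K(1)]
      by (intro image_cong) (auto simp: antiiso_point_map_point_act[OF \<phi> that])
    also have "\<dots> = (\<lambda>p. point_act p (D ** twisted_adj \<phi> N)) ` standard_chain K'"
      unfolding antiiso_point_map_standard_chain[OF K \<phi> u conj]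
      by (simp add: image_image point_act_mult D_def)
    finally show ?thesis .
  qed
  show ?thesis
  proof (intro equalityI subsetI)
    fix C
    assume "C \<in> (\<lambda>C. antiiso_point_map \<phi> ` C) ` chain_set K"
    then obtain M N where MN: "M ** N = mat 1" "N ** M = mat 1"
      and C: "C = antiiso_point_map \<phi> ` (\<lambda>p. point_act p M) ` standard_chain K"
      unfolding chain_set_def invertible_def by blast
    have "invertible D" "invertible N"
      using D MN unfolding invertible_def by blast+
    then have "invertible (D ** twisted_adj \<phi> N)"
      using invertible_twisted_adj[OF \<phi>] by (intro invertible_mult)
    then show "C \<in> chain_set K'"
      unfolding C image_chain[OF MN] chain_set_def by blast
  next
    fix C
    assume "C \<in> chain_set K'"
    then obtain M N where MN: "M ** N = mat 1" "N ** M = mat 1"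
      and C: "C = (\<lambda>p. point_act p M) ` standard_chain K'"
      unfolding chain_set_def invertible_def by blast
    have "bij \<phi>"
      using \<phi> by (simp add: antiisomorphism_def)
    then have inv: "\<phi> (inv \<phi> x) = x" for x
      by (simp add: bij_is_surj surj_f_inv_f)
    note \<psi> = antiisomorphism_inv[OF \<phi>]
    \<comment> \<open>The equation \<open>D ** twisted_adj \<phi> Y = M\<close> is solved by
      \<open>Y = twisted_adj (inv \<phi>) (D' ** M)\<close>. The preimage chain is given by the
      inverse of \<open>Y\<close>, namely \<open>twisted_adj (inv \<phi>) (N ** D)\<close>.\<close>
    have "(D' ** M) ** (N ** D) = mat 1"
      by (metis D(2) MN(1) matrix_mul_assoc matrix_mul_rid)
    moreover have "(N ** D) ** (D' ** M) = mat 1"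
      by (metis D(1) MN(2) matrix_mul_assoc matrix_mul_rid)
    ultimately have *: "twisted_adj (inv \<phi>) (N ** D) ** twisted_adj (inv \<phi>) (D' ** M) = mat 1"
      "twisted_adj (inv \<phi>) (D' ** M) ** twisted_adj (inv \<phi>) (N ** D) = mat 1"
      using twisted_adj_mult_eq_1[OF \<psi>] by blast+
    have "D ** twisted_adj \<phi> (twisted_adj (inv \<phi>) (D' ** M)) = M"
      by (simp add: twisted_adj_inverse[OF \<psi> \<phi> inv] matrix_mul_assoc D)
    then have "C = antiiso_point_map \<phi> ` (\<lambda>p. point_act p (twisted_adj (inv \<phi>) (N ** D))) ` standard_chain K"
      by (simp add: C image_chain[OF *])
    moreover have "invertible (twisted_adj (inv \<phi>) (N ** D))"
      using * unfolding invertible_def by blast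
    ultimately show "C \<in> (\<lambda>C. antiiso_point_map \<phi> ` C) ` chain_set K"
      unfolding chain_set_def by blast
  qed
qed

section \<open>Products of the matrices \<open>E t\<close>\<close>

lemma twisted_adj_inverse_E_prod:
  assumes \<phi>: "antiisomorphism \<phi>"
  shows "\<exists>N. E_prod t n ** N = mat 1 \<and> N ** E_prod t n = mat 1 \<and>
    twisted_adj \<phi> N = E_prod (\<lambda>i. \<phi> (t i)) n"
proof (induction n)
  case 0
  show ?case
    by (intro exI[of _ "mat 1"]) (simp add: twisted_adj_mat_1[OF \<phi>])
next
  case (Suc n)
  then obtain N where N: "E_prod t n ** N = mat 1" "N ** E_prod t n = mat 1"
    "twisted_adj \<phi> N = E_prod (\<lambda>i. \<phi> (t i)) n" by blast
  define s where "s = t (Suc n)"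
  \<comment> \<open>\<open>F\<close> is the inverse of \<open>E s\<close>, and its twisted adjugate
    is \<open>E (\<phi> s)\<close>. The inverse of the longer product is \<open>N ** F\<close>,
    whose order \<open>twisted_adj\<close> reverses, so the new factor again stands on the
    left.\<close>
  define F :: "'a^2^2" where "F = vector [vector [0, - 1], vector [1, s]]"
  have F: "E s ** F = mat 1" "F ** E s = mat 1"
    by (simp_all add: E_def F_def matrix2_simps)
  have "twisted_adj \<phi> F = E (\<phi> s)"
    by (simp add: E_def F_def twisted_adj_def antiisomorphism_simps[OF \<phi>])
  moreover have "(E s ** E_prod t n) ** (N ** F) = mat 1"
    by (metis F(1) N(1) matrix_mul_assoc matrix_mul_rid)
  moreover have "(N ** F) ** (E s ** E_prod t n) = mat 1"
    by (metis F(2) N(2) matrix_mul_assoc matrix_mul_rid)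
  ultimately show ?case
    by (intro exI[of _ "N ** F"]) (simp add: twisted_adj_mult[OF \<phi>] N(3) flip: s_def)
qed

theorem mainTheorem4:
  fixes K :: "'a::ring_1 set" and K' :: "'b::ring_1 set"
    and \<phi> :: "'a \<Rightarrow> 'b"
  assumes "proper_subfield K" and "proper_subfield K'"
    and "antiisomorphism \<phi>"
    and "\<exists>u' v'. u' * v' = 1 \<and> v' * u' = 1 \<and> \<phi> ` K = {v' * k' * u' | k'. k' \<in> K'}"
  shows "geometry_iso (antiiso_point_map \<phi>) (chain_geometry K) (chain_geometry K') \<and>
    (\<forall>(n::nat) (t::nat \<Rightarrow> 'a).
       antiiso_point_map \<phi> (point_act (left_span (vector [1, 0])) (E_prod t n)) =
       point_act (left_span (vector [1, 0])) (E_prod (\<lambda>i. \<phi> (t i)) n))"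
proof (intro conjI allI)
  have K: "is_subfield K" "is_subfield K'"
    using assms(1,2) by (simp_all add: proper_subfield_def)
  note bij = bij_betw_antiiso_point_map[OF assms(3)]
  \<comment> \<open>Chains are sets of points, so injectivity on chains is inherited from
    injectivity on points.\<close>
  have "inj_on (\<lambda>C. antiiso_point_map \<phi> ` C) (chain_set K)"
    using inj_on_image_Pow[OF bij_betw_imp_inj_on[OF bij]] chain_set_subset_Pow_proj_line[OF K(1)]
    by (rule inj_on_subset)
  moreover obtain u v where "u * v = 1" "v * u = 1" "\<phi> ` K = {v * k * u | k. k \<in> K'}"
    using assms(4) by blast
  then have "(\<lambda>C. antiiso_point_map \<phi> ` C) ` chain_set K = chain_set K'"
    by (rule image_antiiso_point_map_chain_set[OF K assms(3)])
  ultimately show "geometry_iso (antiiso_point_map \<phi>) (chain_geometry K) (chain_geometry K')"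
    using bij by (simp add: geometry_iso_def chain_geometry_def bij_betw_def)
  show "antiiso_point_map \<phi> (point_act (left_span (vector [1, 0])) (E_prod t n)) =
      point_act (left_span (vector [1, 0])) (E_prod (\<lambda>i. \<phi> (t i)) n)" for n t
  proof -
    obtain N where "E_prod t n ** N = mat 1" "N ** E_prod t n = mat 1"
      "twisted_adj \<phi> N = E_prod (\<lambda>i. \<phi> (t i)) n"
      using twisted_adj_inverse_E_prod[OF assms(3)] by blast
    then show ?thesis
      by (simp add: antiiso_point_map_base[OF assms(3)])
  qed
qed

end
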